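(* Let $R$ be a non-associative ring and let $\sigma\colon R\to R$ be an additive bijection with $\sigma(1)=1$. Then the generalized Laurent polynomial ring $R[X^{\pm};\sigma]$ is simple if and only if $R$ is $\sigma$-simple and there do not exist $u\in N_m(R)\cap N_r(R)\cap R^\times$ and a non-zero $n\in\mathbb{Z}$ such that for all $r\in R$ the following equalities hold: (i) $\sigma^n(r)=u^{-1}ru$; (ii) $\sigma(ru)=\sigma(r)u$.
   Context: A non-associative ring is a unital ring that is not necessarily associative. "Ideal" means two-sided ideal, and a non-associative ring is simple if it is non-zero and its only ideals are $\{0\}$ and itself. The associator is $(r,s,t)=(rs)t-r(st)$. The middle nucleus is $N_m(R)=\{s\in R: (r,s,t)=0 \text{ for all } r,t\in R\}$ and the right nucleus is $N_r(R)=\{t\in R:(r,s,t)=0\text{ for all } r,s\in R\}$. $R^\times$ is the set of elements $u\in R$ for which there exist $v,w\in R$ with $vu=1$ and $uw=1$; if $u\in N_m(R)\cap R^\times$, then the left inverse $v$ and right inverse $w$ are unique and equal, and $u^{-1}$ denotes this element. For $u\in N_r(R)$ one has $(u^{-1}r)u=u^{-1}(ru)$, so $u^{-1}ru$ is unambiguous. For an additive bijection $\sigma$ on $R$ with $\sigma(1)=1$, $R[X^{\pm};\sigma]$ is the additive group of formal sums $\sum_{i\in\mathbb{Z}}r_iX^i$ ($r_i\in R$, all but finitely many zero) with pointwise addition and multiplication given by the biadditive extension of $(rX^m)(sX^n)=(r\sigma^m(s))X^{m+n}$ for $r,s\in R$, $m,n\in\mathbb{Z}$; it is a non-associative ring.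 An ideal $I$ of $R$ is a $\sigma$-ideal if $\sigma(I)=I$; $R$ is $\sigma$-simple if $\{0\}$ and $R$ are the only $\sigma$-ideals of $R$. *)

theory Defs
  imports "HOL-Algebra.AbelCoset"
begin

text \<open>The rings of HOL-Algebra are associative, so unital non-associative rings, their ideals and
  their simplicity are introduced here, on the same records. The zero ring is allowed.\<close>

locale nonassoc_ring = abelian_group R for R (structure) +
  assumes m_closed [intro, simp]:
      "\<lbrakk>x \<in> carrier R; y \<in> carrier R\<rbrakk> \<Longrightarrow> x \<otimes> y \<in> carrier R"
    and one_closed [intro, simp]: "\<one> \<in> carrier R"
    and l_one [simp]: "x \<in> carrier R \<Longrightarrow> \<one> \<otimes> x = x"
    and r_one [simp]: "x \<in> carrier R \<Longrightarrow> x \<otimes> \<one> = x"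
    and l_distr: "\<lbrakk>x \<in> carrier R; y \<in> carrier R; z \<in> carrier R\<rbrakk>
      \<Longrightarrow> (x \<oplus> y) \<otimes> z = x \<otimes> z \<oplus> y \<otimes> z"
    and r_distr: "\<lbrakk>x \<in> carrier R; y \<in> carrier R; z \<in> carrier R\<rbrakk>
      \<Longrightarrow> z \<otimes> (x \<oplus> y) = z \<otimes> x \<oplus> z \<otimes> y"

definition na_ideal :: "'a set \<Rightarrow> ('a, 'm) ring_scheme \<Rightarrow> bool" where
  "na_ideal I R \<longleftrightarrow> additive_subgroup I R \<and>
     (\<forall>a\<in>I. \<forall>r\<in>carrier R. r \<otimes>\<^bsub>R\<^esub> a \<in> I \<and> a \<otimes>\<^bsub>R\<^esub> r \<in> I)"

definition na_simple :: "('a, 'm) ring_scheme \<Rightarrow> bool" where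
  "na_simple R \<longleftrightarrow> carrier R \<noteq> {\<zero>\<^bsub>R\<^esub>} \<and>
     (\<forall>I. na_ideal I R \<longrightarrow> I = {\<zero>\<^bsub>R\<^esub>} \<or> I = carrier R)"

definition sigma_ideal :: "('a \<Rightarrow> 'a) \<Rightarrow> 'a set \<Rightarrow> ('a, 'm) ring_scheme \<Rightarrow> bool" where
  "sigma_ideal \<sigma> I R \<longleftrightarrow> na_ideal I R \<and> \<sigma> ` I = I"

text \<open>Unlike simplicity, \<open>\<sigma>\<close>-simplicity does not exclude the zero ring.\<close>

definition sigma_simple :: "('a \<Rightarrow> 'a) \<Rightarrow> ('a, 'm) ring_scheme \<Rightarrow> bool" where
  "sigma_simple \<sigma> R \<longleftrightarrow>
     (\<forall>I. sigma_ideal \<sigma> I R \<longrightarrow> I = {\<zero>\<^bsub>R\<^esub>} \<or> I = carrier R)"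

definition associator :: "('a, 'm) ring_scheme \<Rightarrow> 'a \<Rightarrow> 'a \<Rightarrow> 'a \<Rightarrow> 'a" where
  "associator R r s t = ((r \<otimes>\<^bsub>R\<^esub> s) \<otimes>\<^bsub>R\<^esub> t) \<ominus>\<^bsub>R\<^esub> (r \<otimes>\<^bsub>R\<^esub> (s \<otimes>\<^bsub>R\<^esub> t))"

definition middle_nucleus :: "('a, 'm) ring_scheme \<Rightarrow> 'a set" where
  "middle_nucleus R =
     {s \<in> carrier R. \<forall>r\<in>carrier R. \<forall>t\<in>carrier R. associator R r s t = \<zero>\<^bsub>R\<^esub>}"

definition right_nucleus :: "('a, 'm) ring_scheme \<Rightarrow> 'a set" where
  "right_nucleus R =
     {t \<in> carrier R. \<forall>r\<in>carrier R. \<forall>s\<in>carrier R. associator R r s t = \<zero>\<^bsub>R\<^esub>}"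

text \<open>The left and right inverses are not required to coincide, in contrast to \<^const>\<open>Units\<close>.\<close>

definition na_units :: "('a, 'm) ring_scheme \<Rightarrow> 'a set" where
  "na_units R = {u \<in> carrier R. \<exists>v\<in>carrier R. \<exists>w\<in>carrier R.
     v \<otimes>\<^bsub>R\<^esub> u = \<one>\<^bsub>R\<^esub> \<and> u \<otimes>\<^bsub>R\<^esub> w = \<one>\<^bsub>R\<^esub>}"

text \<open>Integer powers of a bijection of the set \<open>A\<close> onto itself; values are meaningful only on \<open>A\<close>.\<close>

definition int_iter :: "'a set \<Rightarrow> ('a \<Rightarrow> 'a) \<Rightarrow> int \<Rightarrow> 'a \<Rightarrow> 'a" where
  "int_iter A f n = (if 0 \<le> n then f ^^ nat n else inv_into A f ^^ nat (- n))"

text \<open>A formal sum \<open>\<Sum>\<^sub>i r\<^sub>i X\<^sup>i\<close> is the finitely supported function \<open>i \<mapsto> r\<^sub>i\<close>. The coefficient of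
  \<open>X\<^sup>k\<close> in \<open>(\<Sum>\<^sub>i f\<^sub>i X\<^sup>i) (\<Sum>\<^sub>j g\<^sub>j X\<^sup>j)\<close> collects the terms with \<open>j = k - i\<close>.\<close>

definition laurent :: "('a, 'm) ring_scheme \<Rightarrow> ('a \<Rightarrow> 'a) \<Rightarrow> (int \<Rightarrow> 'a) ring" where
  "laurent R \<sigma> =
     \<lparr>carrier = {f. (\<forall>i. f i \<in> carrier R) \<and> finite {i. f i \<noteq> \<zero>\<^bsub>R\<^esub>}},
      mult = (\<lambda>f g k. \<Oplus>\<^bsub>R\<^esub>i\<in>{i. f i \<noteq> \<zero>\<^bsub>R\<^esub>}.
                 f i \<otimes>\<^bsub>R\<^esub> int_iter (carrier R) \<sigma> i (g (k - i))),
      one = (\<lambda>k. if k = 0 then \<one>\<^bsub>R\<^esub> else \<zero>\<^bsub>R\<^esub>),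
      zero = (\<lambda>k. \<zero>\<^bsub>R\<^esub>),
      add = (\<lambda>f g k. f k \<oplus>\<^bsub>R\<^esub> g k)\<rparr>"

text \<open>For a unit \<open>u\<close> in the middle nucleus all left and right inverses agree, so that
  \<^const>\<open>m_inv\<close>, a definite description of a two-sided inverse, denotes this element.\<close>

lemma (in nonassoc_ring) middle_nucleus_inverse_eq:
  assumes "u \<in> middle_nucleus R" "v \<in> carrier R" "w \<in> carrier R" "v \<otimes> u = \<one>" "u \<otimes> w = \<one>"
  shows "v = w"
proof -
  have u: "u \<in> carrier R" and a: "associator R v u w = \<zero>"
    using assms by (auto simp: middle_nucleus_def)
  have "w \<ominus> v = \<zero>" using a assms by (simp add: associator_def)
  thus ?thesis using assms(2,3) by (metis a_minus_def add.inv_closed add.inv_equality add.inv_inv)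
qed

lemma (in nonassoc_ring) middle_nucleus_inv_eq:
  assumes "u \<in> middle_nucleus R" "v \<in> carrier R" "w \<in> carrier R" "v \<otimes> u = \<one>" "u \<otimes> w = \<one>"
  shows "inv u = v" and "inv u = w"
proof -
  have "v = w" using assms by (rule middle_nucleus_inverse_eq)
  moreover have "inv u = v"
    unfolding m_inv_def
  proof (rule the_equality)
    show "v \<in> carrier R \<and> u \<otimes> v = \<one> \<and> v \<otimes> u = \<one>" using assms \<open>v = w\<close> by simp
  next
    fix y assume "y \<in> carrier R \<and> u \<otimes> y = \<one> \<and> y \<otimes> u = \<one>"
    thus "y = v" using middle_nucleus_inverse_eq[OF assms(1,2), of y] assms(4) by simp
  qed
  ultimately show "inv u = v" "inv u = w" by simp_all
qed

lemma (in nonassoc_ring) laurent_mult_monom: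
  assumes \<sigma>: "\<sigma> \<in> iso (add_monoid R) (add_monoid R)"
    and r: "r \<in> carrier R" and s: "s \<in> carrier R"
  shows "(\<lambda>i. if i = m then r else \<zero>) \<otimes>\<^bsub>laurent R \<sigma>\<^esub> (\<lambda>i. if i = n then s else \<zero>)
    = (\<lambda>i. if i = m + n then r \<otimes> int_iter (carrier R) \<sigma> m s else \<zero>)"
proof -
  have bij: "bij_betw \<sigma> (carrier R) (carrier R)"
    and hom: "\<sigma> \<in> hom (add_monoid R) (add_monoid R)"
    using \<sigma> by (auto simp: iso_def)
  have \<sigma>0: "\<sigma> \<zero> = \<zero>"
    using hom_one[OF hom a_group a_group] by simp
  have inv0: "inv_into (carrier R) \<sigma> \<zero> = \<zero>"
    using bij \<sigma>0 by (metis bij_betw_inv_into_left zero_closed)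
  have it0: "int_iter (carrier R) \<sigma> k \<zero> = \<zero>" for k
  proof -
    have "(\<sigma> ^^ j) \<zero> = \<zero>" "(inv_into (carrier R) \<sigma> ^^ j) \<zero> = \<zero>" for j
      by (induction j) (simp_all add: \<sigma>0 inv0)
    thus ?thesis by (simp add: int_iter_def)
  qed
  have itc: "int_iter (carrier R) \<sigma> k s \<in> carrier R" for k
  proof -
    have "(\<sigma> ^^ j) s \<in> carrier R" "(inv_into (carrier R) \<sigma> ^^ j) s \<in> carrier R" for j
      using s bij bij_betw_inv_into[OF bij]
      by (induction j) (auto simp: bij_betw_apply)
    thus ?thesis by (simp add: int_iter_def)
  qed
  have z1: "x \<otimes> \<zero> = \<zero>" if "x \<in> carrier R" for x
    using r_distr[of \<zero> \<zero> x] that by (simp add: add.r_cancel_one')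
  have z2: "\<zero> \<otimes> x = \<zero>" if "x \<in> carrier R" for x
    using l_distr[of \<zero> \<zero> x] that by (simp add: add.r_cancel_one')
  show ?thesis
  proof (cases "r = \<zero>")
    case True
    thus ?thesis by (auto simp: laurent_def fun_eq_iff z2 itc)
  next
    case False
    hence "{i. (if i = m then r else \<zero>) \<noteq> \<zero>} = {m}" by auto
    thus ?thesis
      using r by (auto simp: laurent_def fun_eq_iff it0 z1 itc)
  qed
qed

end

theory Submission
  imports Defs
begin

text \<open>If \<open>u\<close> and \<open>n\<close> satisfy (i) and (ii), then \<open>c = u X\<^sup>n\<close> commutes with everything and associates from
  the right, so the multiples \<open>f - f c\<close> of \<open>1 - c\<close> form an ideal; it is proper, because \<open>f - f c = 1\<close>
  would force infinitely many non-zero coefficients of \<open>f\<close>.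

  Conversely, take a non-zero ideal \<open>I\<close> of the Laurent ring and the least \<open>d\<close> such that \<open>I\<close> has a
  non-zero element supported in \<open>{0..d}\<close>. Such elements are determined by their constant coefficient,
  and for each \<open>j\<close> their \<open>j\<close>-th coefficients form a \<open>\<sigma>\<close>-ideal. By \<open>\<sigma>\<close>-simplicity one of them, \<open>f\<close>,
  has constant coefficient \<open>1\<close>, and one, \<open>g\<close>, has top coefficient \<open>1\<close>. If \<open>d = 0\<close> then \<open>1 \<in> I\<close>.
  Otherwise let \<open>u\<close> be the top coefficient of \<open>f\<close>: two elements built from \<open>f\<close>, such as \<open>r f\<close> and \<open>f r\<close>,
  agree once their constant coefficients do, and comparing their top coefficients gives all the
  required properties of \<open>u\<close>; its inverse is the constant coefficient of \<open>g\<close>.\<close>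

section \<open>Additive maps and finite sums\<close>

lemma (in abelian_group) hom_finsum:
  assumes h: "h \<in> hom (add_monoid G) (add_monoid G)" and f: "f \<in> A \<rightarrow> carrier G"
  shows "h (\<Oplus>i\<in>A. f i) = (\<Oplus>i\<in>A. h (f i))"
proof -
  have h0: "h \<zero> = \<zero>" using hom_one[OF h a_group a_group] by simp
  have hadd: "h (x \<oplus> y) = h x \<oplus> h y" if "x \<in> carrier G" "y \<in> carrier G" for x y
    using hom_mult[OF h] that by simp
  have hc: "h x \<in> carrier G" if "x \<in> carrier G" for x
    using hom_in_carrier[OF h] that by simp
  show ?thesis using f
  \<comment> \<open>For infinite \<open>A\<close> both sums take the default value \<zero>, which
    \<open>h\<close> preserves; this is the extra case of the rule.\<close>
  proof (induction A rule: infinite_finite_induct)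
    case (insert x A)
    then have "f x \<in> carrier G" "f \<in> A \<rightarrow> carrier G" by auto
    moreover from this have "(\<lambda>i. h (f i)) \<in> A \<rightarrow> carrier G" using hc by auto
    ultimately show ?case using insert by (simp add: hadd hc)
  qed (simp_all add: h0)
qed

lemma (in abelian_group) finsum_mem_additive_subgroup:
  assumes "additive_subgroup I G" "f \<in> A \<rightarrow> I"
  shows "(\<Oplus>i\<in>A. f i) \<in> I"
  using assms(2)
proof (induction A rule: infinite_finite_induct)
  case (insert x A)
  have "I \<subseteq> carrier G" using assms(1) by (rule additive_subgroup.a_subset)
  then have "f \<in> A \<rightarrow> carrier G" "f x \<in> carrier G" using insert by auto
  then show ?case using insert additive_subgroup.a_closed[OF assms(1)] by simp
qed (simp_all add: additive_subgroup.zero_closed[OF assms(1)])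

context nonassoc_ring
begin

text \<open>Once distributivity is read as additivity of one-sided multiplication, the same facts on
  negatives, differences and sums serve multiplications and powers of \<sigma> alike.\<close>

lemma l_mult_hom: "x \<in> carrier R \<Longrightarrow> (\<lambda>y. x \<otimes> y) \<in> hom (add_monoid R) (add_monoid R)"
  by (rule homI) (auto simp: r_distr)

lemma r_mult_hom: "x \<in> carrier R \<Longrightarrow> (\<lambda>y. y \<otimes> x) \<in> hom (add_monoid R) (add_monoid R)"
  by (rule homI) (auto simp: l_distr)

lemma r_null [simp]: "x \<in> carrier R \<Longrightarrow> x \<otimes> \<zero> = \<zero>"
  using hom_one[OF l_mult_hom a_group a_group, of x] by simp

lemma l_null [simp]: "x \<in> carrier R \<Longrightarrow> \<zero> \<otimes> x = \<zero>"
  using hom_one[OF r_mult_hom a_group a_group, of x] by simp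

lemma a_inv_zero [simp]: "\<ominus> \<zero> = \<zero>"
  using minus_equality[of \<zero> \<zero>] by simp

lemma hom_a_inv:
  assumes "h \<in> hom (add_monoid R) (add_monoid R)" "x \<in> carrier R"
  shows "h (\<ominus> x) = \<ominus> h x"
proof -
  interpret group_hom "add_monoid R" "add_monoid R" h
    using assms(1) by (simp add: group_hom_def group_hom_axioms_def a_group)
  show ?thesis using hom_inv[of x] assms(2) by (simp add: a_inv_def)
qed

lemma hom_a_minus:
  assumes "h \<in> hom (add_monoid R) (add_monoid R)" "x \<in> carrier R" "y \<in> carrier R"
  shows "h (x \<ominus> y) = h x \<ominus> h y"
  using hom_mult[OF assms(1)] hom_a_inv[OF assms(1)] assms(2,3) by (simp add: a_minus_def)

lemma finsum_a_minus:
  assumes "f \<in> A \<rightarrow> carrier R" "g \<in> A \<rightarrow> carrier R"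
  shows "(\<Oplus>i\<in>A. f i \<ominus> g i) = (\<Oplus>i\<in>A. f i) \<ominus> (\<Oplus>i\<in>A. g i)"
proof -
  have h: "a_inv R \<in> hom (add_monoid R) (add_monoid R)"
    by (rule homI) (auto simp: minus_add add.m_comm)
  have "(\<lambda>i. \<ominus> g i) \<in> A \<rightarrow> carrier R" using assms by auto
  then show ?thesis
    using assms hom_finsum[OF h assms(2)] by (simp add: a_minus_def finsum_addf)
qed

lemma minus_eq_zero_iff:
  assumes "x \<in> carrier R" "y \<in> carrier R"
  shows "x \<ominus> y = \<zero> \<longleftrightarrow> x = y"
  using assms by (metis a_minus_def add.inv_closed add.inv_equality minus_minus r_neg)

lemma middle_nucleusD:
  assumes "s \<in> middle_nucleus R" "r \<in> carrier R" "t \<in> carrier R"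
  shows "(r \<otimes> s) \<otimes> t = r \<otimes> (s \<otimes> t)"
  using assms minus_eq_zero_iff by (auto simp: middle_nucleus_def associator_def)

lemma right_nucleusD:
  assumes "t \<in> right_nucleus R" "r \<in> carrier R" "s \<in> carrier R"
  shows "(r \<otimes> s) \<otimes> t = r \<otimes> (s \<otimes> t)"
  using assms minus_eq_zero_iff by (auto simp: right_nucleus_def associator_def)

end

section \<open>Integer powers of an additive bijection\<close>

text \<open>The isomorphism is one of additive groups: \<sigma> need not respect products, which is
  why (ii) is a genuine condition.\<close>

locale twisted_ring = nonassoc_ring +
  fixes \<sigma> :: "'a \<Rightarrow> 'a"
  assumes iso: "\<sigma> \<in> iso (add_monoid R) (add_monoid R)"
    and sigma_one [simp]: "\<sigma> \<one> = \<one>"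
begin

abbreviation pw :: "int \<Rightarrow> 'a \<Rightarrow> 'a" where "pw \<equiv> int_iter (carrier R) \<sigma>"

abbreviation L :: "(int \<Rightarrow> 'a) ring" where "L \<equiv> laurent R \<sigma>"

abbreviation supp :: "(int \<Rightarrow> 'a) \<Rightarrow> int set" where "supp f \<equiv> {i. f i \<noteq> \<zero>}"

lemma sigma_bij: "bij_betw \<sigma> (carrier R) (carrier R)"
  using iso by (simp add: iso_def)

lemma pw_0 [simp]: "pw 0 x = x"
  by (simp add: int_iter_def)

lemma pw_1 [simp]: "pw 1 x = \<sigma> x"
  by (simp add: int_iter_def)

lemma pw_hom: "pw k \<in> hom (add_monoid R) (add_monoid R)"
proof -
  have f: "f ^^ n \<in> hom (add_monoid R) (add_monoid R)"
    if "f \<in> hom (add_monoid R) (add_monoid R)" for f and n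
    by (induction n) (use that in \<open>auto simp: hom_def Pi_iff\<close>)
  have "inv_into (carrier R) \<sigma> \<in> iso (add_monoid R) (add_monoid R)"
    using group.iso_set_sym[OF a_group iso] by simp
  then show ?thesis using f iso by (simp add: int_iter_def iso_def)
qed

lemma pw_closed [simp]: "x \<in> carrier R \<Longrightarrow> pw k x \<in> carrier R"
  using hom_in_carrier[OF pw_hom] by simp

lemma sigma_closed [simp]: "x \<in> carrier R \<Longrightarrow> \<sigma> x \<in> carrier R"
  using pw_closed[of x 1] by simp

lemma pw_zero [simp]: "pw k \<zero> = \<zero>"
  using hom_one[OF pw_hom a_group a_group] by simp

lemma pw_add_one:
  assumes "x \<in> carrier R" shows "pw (k + 1) x = \<sigma> (pw k x)"
proof (cases "0 \<le> k")
  case True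
  then show ?thesis by (simp add: int_iter_def nat_add_distrib)
next
  case False
  \<comment> \<open>\<open>int_iter\<close> changes its formula at 0: below it, passing from
    \<open>k\<close> to \<open>k + 1\<close> removes one application of the inverse.\<close>
  then have "nat (- k) = Suc (nat (- (k + 1)))" by simp
  then have e: "pw k x = inv_into (carrier R) \<sigma> (pw (k + 1) x)"
    using False by (auto simp: int_iter_def)
  show ?thesis
    using sigma_bij assms unfolding e by (simp add: bij_betw_inv_into_right)
qed

text \<open>Writing the inverse of \<sigma> as \<open>pw (-1)\<close> makes the closure and
  composition facts for \<open>pw\<close> available in downward inductions.\<close>

lemma pw_diff_one:
  assumes "x \<in> carrier R" shows "pw (k - 1) x = pw (-1) (pw k x)"
proof -
  have "pw k x = \<sigma> (pw (k - 1) x)" using pw_add_one[OF assms, of "k - 1"] by simp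
  then have "inv_into (carrier R) \<sigma> (pw k x) = pw (k - 1) x"
    using sigma_bij assms by (simp add: bij_betw_inv_into_left)
  then show ?thesis by (simp add: int_iter_def)
qed

lemma pw_pw: "x \<in> carrier R \<Longrightarrow> pw m (pw n x) = pw (m + n) x"
proof (induction m rule: int_induct[where k = 0])
  case (step1 i)
  then show ?case using pw_add_one[of "pw n x" i] pw_add_one[of x "i + n"] by (simp add: ac_simps)
next
  case (step2 i)
  then show ?case using pw_diff_one[of "pw n x" i] pw_diff_one[of x "i + n"] by (simp add: algebra_simps)
qed simp

lemma pw_one [simp]: "pw k \<one> = \<one>"
proof (induction k rule: int_induct[where k = 0])
  case (step1 i)
  then show ?case by (simp add: pw_add_one)
next
  case (step2 i)
  then show ?case using pw_diff_one[of \<one> i] pw_pw[of \<one> "-1" 1] by simp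
qed simp

section \<open>Addition and multiplication of Laurent polynomials\<close>

lemma laurent_carrier: "f \<in> carrier L \<longleftrightarrow> (\<forall>i. f i \<in> carrier R) \<and> finite (supp f)"
  by (simp add: laurent_def)

lemma laurent_coeff: "f \<in> carrier L \<Longrightarrow> f i \<in> carrier R"
  by (simp add: laurent_carrier)

lemma laurent_zero: "\<zero>\<^bsub>L\<^esub> = (\<lambda>k. \<zero>)"
  by (simp add: laurent_def)

lemma laurent_add: "f \<oplus>\<^bsub>L\<^esub> g = (\<lambda>k. f k \<oplus> g k)"
  by (simp add: laurent_def)

text \<open>Indices outside the support add zero terms. The freedom in \<open>A\<close> lets
  products with different left factors be summed over a common index set.\<close>

lemma laurent_mult:
  assumes "f \<in> carrier L" "g \<in> carrier L" "finite A" "supp f \<subseteq> A"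
  shows "(f \<otimes>\<^bsub>L\<^esub> g) k = (\<Oplus>i\<in>A. f i \<otimes> pw i (g (k - i)))"
proof -
  have "(f \<otimes>\<^bsub>L\<^esub> g) k = (\<Oplus>i\<in>supp f. f i \<otimes> pw i (g (k - i)))"
    by (simp add: laurent_def)
  also have "\<dots> = (\<Oplus>i\<in>A. f i \<otimes> pw i (g (k - i)))"
    using assms by (intro add.finprod_mono_neutral_cong_left) (auto simp: laurent_coeff)
  finally show ?thesis .
qed

lemma laurent_add_closed:
  assumes "f \<in> carrier L" "g \<in> carrier L" shows "f \<oplus>\<^bsub>L\<^esub> g \<in> carrier L"
proof -
  have "supp (\<lambda>k. f k \<oplus> g k) \<subseteq> supp f \<union> supp g" by auto
  then show ?thesis using assms
    by (auto simp: laurent_carrier laurent_add intro: finite_subset)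
qed

lemma laurent_uminus_closed:
  assumes "f \<in> carrier L" shows "(\<lambda>k. \<ominus> f k) \<in> carrier L"
proof -
  have "supp (\<lambda>k. \<ominus> f k) \<subseteq> supp f" by auto
  then show ?thesis using assms
    by (auto simp: laurent_carrier intro: finite_subset)
qed

lemma laurent_abelian_group: "abelian_group L"
proof (rule abelian_groupI)
  fix f assume f: "f \<in> carrier L"
  have "(\<lambda>k. \<ominus> f k) \<oplus>\<^bsub>L\<^esub> f = \<zero>\<^bsub>L\<^esub>"
    using f by (simp add: laurent_add laurent_zero laurent_coeff l_neg)
  then show "\<exists>g\<in>carrier L. g \<oplus>\<^bsub>L\<^esub> f = \<zero>\<^bsub>L\<^esub>"
    using laurent_uminus_closed[OF f] by blast
next
  show "\<zero>\<^bsub>L\<^esub> \<in> carrier L" by (simp add: laurent_zero laurent_carrier)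
next
  fix f g h assume "f \<in> carrier L" "g \<in> carrier L" "h \<in> carrier L"
  then show "f \<oplus>\<^bsub>L\<^esub> g \<oplus>\<^bsub>L\<^esub> h = f \<oplus>\<^bsub>L\<^esub> (g \<oplus>\<^bsub>L\<^esub> h)"
    by (simp add: laurent_add laurent_coeff a_assoc)
next
  fix f g assume "f \<in> carrier L" "g \<in> carrier L"
  then show "f \<oplus>\<^bsub>L\<^esub> g = g \<oplus>\<^bsub>L\<^esub> f"
    by (simp add: laurent_add laurent_coeff a_comm)
next
  fix f assume "f \<in> carrier L"
  then show "\<zero>\<^bsub>L\<^esub> \<oplus>\<^bsub>L\<^esub> f = f"
    by (simp add: laurent_add laurent_zero laurent_coeff)
qed (rule laurent_add_closed)

lemma laurent_a_inv:
  assumes "f \<in> carrier L" shows "\<ominus>\<^bsub>L\<^esub> f = (\<lambda>k. \<ominus> f k)"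
proof -
  interpret L: abelian_group L by (rule laurent_abelian_group)
  have "(\<lambda>k. \<ominus> f k) \<oplus>\<^bsub>L\<^esub> f = \<zero>\<^bsub>L\<^esub>"
    using assms by (simp add: laurent_add laurent_zero laurent_coeff l_neg)
  then show ?thesis using L.minus_equality assms laurent_uminus_closed by simp
qed

lemma laurent_mult_closed:
  assumes "f \<in> carrier L" "g \<in> carrier L" shows "f \<otimes>\<^bsub>L\<^esub> g \<in> carrier L"
proof -
  \<comment> \<open>The sumset of the supports: outside it every term of the convolution has a zero
    factor.\<close>
  let ?B = "(\<lambda>(i, j). i + j) ` (supp f \<times> supp g)"
  have F: "finite (supp f)" "finite (supp g)" using assms by (auto simp: laurent_carrier)
  have "(f \<otimes>\<^bsub>L\<^esub> g) k = \<zero>" if k: "k \<notin> ?B" for k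
  proof -
    have "f i \<otimes> pw i (g (k - i)) = \<zero>" if "i \<in> supp f" for i
    proof -
      have "k - i \<notin> supp g" using k that by force
      then show ?thesis using assms by (simp add: laurent_coeff)
    qed
    then show ?thesis
      using laurent_mult[OF assms F(1) order_refl] by (auto intro: add.finprod_one_eqI)
  qed
  then have "supp (f \<otimes>\<^bsub>L\<^esub> g) \<subseteq> ?B" by blast
  then have "finite (supp (f \<otimes>\<^bsub>L\<^esub> g))" using F by (auto intro: finite_subset)
  moreover have "(f \<otimes>\<^bsub>L\<^esub> g) k \<in> carrier R" for k
    using laurent_mult[OF assms F(1) order_refl] assms by (auto simp: laurent_coeff intro!: finsum_closed)
  ultimately show ?thesis by (simp add: laurent_carrier)
qed

section \<open>Monomials\<close>

definition monom :: "'a \<Rightarrow> int \<Rightarrow> int \<Rightarrow> 'a" where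
  "monom r n = (\<lambda>i. if i = n then r else \<zero>)"

lemma monom_closed [simp]: "r \<in> carrier R \<Longrightarrow> monom r n \<in> carrier L"
proof -
  have "supp (monom r n) \<subseteq> {n}" by (auto simp: monom_def)
  then show "r \<in> carrier R \<Longrightarrow> ?thesis"
    by (auto simp: laurent_carrier monom_def intro: finite_subset)
qed

lemma monom_mult_left:
  assumes "r \<in> carrier R" "g \<in> carrier L"
  shows "monom r m \<otimes>\<^bsub>L\<^esub> g = (\<lambda>k. r \<otimes> pw m (g (k - m)))"
proof
  fix k
  have "supp (monom r m) \<subseteq> {m}" by (auto simp: monom_def)
  then have "(monom r m \<otimes>\<^bsub>L\<^esub> g) k = (\<Oplus>i\<in>{m}. monom r m i \<otimes> pw i (g (k - i)))"
    using assms by (intro laurent_mult monom_closed) auto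
  then show "(monom r m \<otimes>\<^bsub>L\<^esub> g) k = r \<otimes> pw m (g (k - m))"
    using assms by (simp add: monom_def laurent_coeff)
qed

lemma monom_mult_right:
  assumes "s \<in> carrier R" "g \<in> carrier L"
  shows "g \<otimes>\<^bsub>L\<^esub> monom s n = (\<lambda>k. g (k - n) \<otimes> pw (k - n) s)"
proof
  fix k
  \<comment> \<open>The only index that contributes is \<open>k - n\<close>, which may lie outside
    the support of \<open>g\<close>.\<close>
  let ?A = "insert (k - n) (supp g)"
  have "(g \<otimes>\<^bsub>L\<^esub> monom s n) k = (\<Oplus>i\<in>?A. g i \<otimes> pw i (monom s n (k - i)))"
    using assms by (intro laurent_mult monom_closed) (auto simp: laurent_carrier)
  also have "\<dots> = (\<Oplus>i\<in>?A. if k - n = i then g i \<otimes> pw i s else \<zero>)"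
    using assms by (intro finsum_cong') (auto simp: monom_def laurent_coeff)
  also have "\<dots> = g (k - n) \<otimes> pw (k - n) s"
    using assms by (intro add.finprod_singleton) (auto simp: laurent_carrier)
  finally show "(g \<otimes>\<^bsub>L\<^esub> monom s n) k = g (k - n) \<otimes> pw (k - n) s" .
qed

section \<open>From simplicity of the Laurent ring to \<sigma>-simplicity\<close>

lemma pw_preserves_sigma_ideal:
  assumes "sigma_ideal \<sigma> I R" "x \<in> I"
  shows "pw k x \<in> I"
proof (induction k rule: int_induct[where k = 0])
  have sub: "I \<subseteq> carrier R" and im: "\<sigma> ` I = I"
    using assms(1) additive_subgroup.a_subset by (auto simp: sigma_ideal_def na_ideal_def)
  case (step1 i)
  then show ?case using subsetD[OF sub assms(2)] im by (auto simp: pw_add_one)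
next
  have sub: "I \<subseteq> carrier R" and im: "\<sigma> ` I = I"
    using assms(1) additive_subgroup.a_subset by (auto simp: sigma_ideal_def na_ideal_def)
  case (step2 i)
  \<comment> \<open>Downward steps need a preimage inside \<open>I\<close>, hence the equality in
    the definition of a \<sigma>-ideal and not just stability under \<sigma>.\<close>
  then obtain z where z: "z \<in> I" "pw i x = \<sigma> z" using im by blast
  moreover have "pw (-1) (\<sigma> z) = z" using subsetD[OF sub z(1)] pw_pw[of z "-1" 1] by simp
  ultimately show ?case using subsetD[OF sub assms(2)] pw_diff_one[of x i] by simp
qed (use assms(2) in simp)

text \<open>Coefficientwise closure conditions replace the abstract inverse of
  \<open>add_monoid L\<close>.\<close>

lemma na_ideal_laurentI:
  assumes "I \<subseteq> carrier L" "(\<lambda>k. \<zero>) \<in> I"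
    and "\<And>f g. f \<in> I \<Longrightarrow> g \<in> I \<Longrightarrow> (\<lambda>k. f k \<oplus> g k) \<in> I"
    and "\<And>f. f \<in> I \<Longrightarrow> (\<lambda>k. \<ominus> f k) \<in> I"
    and "\<And>f s. f \<in> I \<Longrightarrow> s \<in> carrier L \<Longrightarrow> s \<otimes>\<^bsub>L\<^esub> f \<in> I \<and> f \<otimes>\<^bsub>L\<^esub> s \<in> I"
  shows "na_ideal I L"
proof -
  have "inv\<^bsub>add_monoid L\<^esub> f \<in> I" if "f \<in> I" for f
    using assms(1,4) that laurent_a_inv[of f] by (auto simp: a_inv_def)
  then have "subgroup I (add_monoid L)"
    using assms(1-3) by (intro subgroup.intro) (auto simp: laurent_add laurent_zero)
  then show ?thesis
    using assms(5) by (auto simp: na_ideal_def intro: additive_subgroupI)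
qed

text \<open>The Laurent polynomials with all coefficients in a \<sigma>-ideal \<open>I\<close> form
  an ideal, and constant monomials recover \<open>I\<close> from it.\<close>

lemma simple_imp_sigma_simple:
  assumes "na_simple L" shows "sigma_simple \<sigma> R"
  unfolding sigma_simple_def
proof (intro allI impI)
  fix I assume I: "sigma_ideal \<sigma> I R"
  then have grp: "additive_subgroup I R"
    and mult: "a \<in> I \<Longrightarrow> r \<in> carrier R \<Longrightarrow> r \<otimes> a \<in> I \<and> a \<otimes> r \<in> I" for a r
    by (auto simp: sigma_ideal_def na_ideal_def)
  have sub: "I \<subseteq> carrier R" using grp by (rule additive_subgroup.a_subset)
  have zero: "\<zero> \<in> I" using grp by (rule additive_subgroup.zero_closed)
  let ?K = "{f \<in> carrier L. \<forall>i. f i \<in> I}"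
  have "na_ideal ?K L"
  proof (rule na_ideal_laurentI)
    fix f s assume f: "f \<in> ?K" and s: "s \<in> carrier L"
    have F: "finite (supp f)" "finite (supp s)" using f s by (auto simp: laurent_carrier)
    \<comment> \<open>Here powers of \<sigma> hit coefficients from \<open>I\<close>; in the product
      with \<open>f\<close> on the left they only hit those of \<open>s\<close>.\<close>
    have "(s \<otimes>\<^bsub>L\<^esub> f) k \<in> I" for k
      using laurent_mult[OF s _ F(2) order_refl] f s mult pw_preserves_sigma_ideal[OF I]
      by (auto intro!: finsum_mem_additive_subgroup[OF grp] simp: laurent_coeff)
    moreover have "(f \<otimes>\<^bsub>L\<^esub> s) k \<in> I" for k
      using laurent_mult[OF _ s F(1) order_refl] f s mult
      by (auto intro!: finsum_mem_additive_subgroup[OF grp] simp: laurent_coeff)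
    ultimately show "s \<otimes>\<^bsub>L\<^esub> f \<in> ?K \<and> f \<otimes>\<^bsub>L\<^esub> s \<in> ?K"
      using f s by (auto simp: laurent_mult_closed)
  next
    fix f g assume "f \<in> ?K" "g \<in> ?K"
    then show "(\<lambda>k. f k \<oplus> g k) \<in> ?K"
      using laurent_add_closed[of f g] additive_subgroup.a_closed[OF grp] by (auto simp: laurent_add)
  next
    fix f assume "f \<in> ?K"
    then show "(\<lambda>k. \<ominus> f k) \<in> ?K"
      using laurent_uminus_closed[of f] additive_subgroup.a_inv_closed[OF grp] by auto
  qed (auto simp: laurent_carrier zero)
  then consider "?K = {\<lambda>k. \<zero>}" | "?K = carrier L"
    using assms by (auto simp: na_simple_def laurent_zero)
  then show "I = {\<zero>} \<or> I = carrier R"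
  proof cases
    case 1
    have "a = \<zero>" if "a \<in> I" for a
    proof -
      have "a \<in> carrier R" using that sub by blast
      then have "monom a 0 \<in> ?K" using that zero monom_closed[of a 0] by (auto simp: monom_def)
      then have "monom a 0 = (\<lambda>k. \<zero>)" using 1 by blast
      then show ?thesis by (metis monom_def)
    qed
    then show ?thesis using zero by blast
  next
    case 2
    then have "monom \<one> 0 \<in> ?K" by simp
    then have "monom \<one> 0 0 \<in> I" by blast
    then have "\<one> \<in> I" by (simp add: monom_def)
    then have "r \<in> I" if "r \<in> carrier R" for r using mult[of \<one> r] that by simp
    then show ?thesis using sub by blast
  qed
qed

section \<open>A twisting unit yields a proper non-zero ideal\<close>

lemma not_laurent_if_infinite_support:
  assumes "inj h" "\<And>j::nat. f (h j) \<noteq> \<zero>"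
  shows "f \<notin> carrier L"
proof
  assume "f \<in> carrier L"
  then have "finite (supp f)" by (simp add: laurent_carrier)
  moreover have "range h \<subseteq> supp f" using assms(2) by auto
  ultimately have "finite (range h)" by (rule rev_finite_subset)
  then show False using assms(1) finite_imageD by blast
qed

text \<open>Equality would give \<open>f (j * n) = f ((j - 1) * n) \<otimes> u\<close> for all
  \<open>j\<close> other than 0. If \<open>f (- n)\<close> is zero then \<open>f 0 = \<one>\<close>,
  and injectivity propagates non-zero values to all \<open>j \<ge> 0\<close>. Otherwise non-zero
  values propagate to all \<open>j < 0\<close>, because a zero factor would give a zero product.
  Either way the support is infinite.\<close>

lemma diff_twisted_shift_ne_one:
  assumes n: "n \<noteq> 0" and f: "f \<in> carrier L" and u: "u \<in> carrier R"
    and inj: "\<And>r. r \<in> carrier R \<Longrightarrow> r \<otimes> u = \<zero> \<Longrightarrow> r = \<zero>" and "\<one> \<noteq> \<zero>"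
  shows "(\<lambda>k. f k \<ominus> f (k - n) \<otimes> u) \<noteq> monom \<one> 0"
proof
  assume eq: "(\<lambda>k. f k \<ominus> f (k - n) \<otimes> u) = monom \<one> 0"
  have fc: "f k \<in> carrier R" for k using f by (rule laurent_coeff)
  have step: "f (j * n) = f ((j - 1) * n) \<otimes> u" if "j \<noteq> 0" for j
  proof -
    have "f (j * n) \<ominus> f (j * n - n) \<otimes> u = \<zero>"
      using fun_cong[OF eq, of "j * n"] that n by (simp add: monom_def)
    then show ?thesis using fc u by (simp add: minus_eq_zero_iff algebra_simps)
  qed
  have inj_h: "inj (\<lambda>j. (int j + c) * e)" if "e \<noteq> 0" for c e
    using that by (auto simp: inj_def)
  show False
  proof (cases "f (- n) = \<zero>")
    case True
    then have "f 0 = \<one>"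
      using fun_cong[OF eq, of 0] fc[of 0] u by (simp add: monom_def a_minus_def)
    \<comment> \<open>The summand 0 matches the index map of \<open>inj_h\<close> at
      \<open>c = 0\<close>.\<close>
    then have "f ((int j + 0) * n) \<noteq> \<zero>" for j
      using assms(5)
    proof (induction j)
      case (Suc j)
      then show ?case using step[of "int j + 1"] inj[of "f (int j * n)"] fc by (auto simp: add.commute)
    qed simp
    then show False using not_laurent_if_infinite_support[OF inj_h[of n 0]] n f by blast
  next
    case False
    have "f ((int j + 1) * - n) \<noteq> \<zero>" for j
    proof (induction j)
      case (Suc j)
      have "f ((int j + 1) * - n) = f ((int (Suc j) + 1) * - n) \<otimes> u"
        using step[of "- (int j + 1)"] by (simp add: algebra_simps)
      then show ?case using Suc u by auto
    qed (use False in simp)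
    then show False using not_laurent_if_infinite_support[OF inj_h[of "- n" 1]] n f by auto
  qed
qed

text \<open>The map \<open>T\<close>, which sends \<open>f\<close> to \<open>f - f c\<close> with
  \<open>c = monom u n\<close>, commutes with multiplication from either side, so its image is an
  ideal. The image is not zero, since \<open>T\<close> of the identity has constant coefficient
  \<one>, and it does not contain the identity by \<open>diff_twisted_shift_ne_one\<close>.\<close>

lemma twisting_unit_imp_not_simple:
  assumes u: "u \<in> middle_nucleus R" "u \<in> right_nucleus R" "u \<in> na_units R" and n: "n \<noteq> 0"
    and conj: "\<And>r. r \<in> carrier R \<Longrightarrow> pw n r = (inv u \<otimes> r) \<otimes> u"
    and lin: "\<And>r. r \<in> carrier R \<Longrightarrow> \<sigma> (r \<otimes> u) = \<sigma> r \<otimes> u"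
  shows "\<not> na_simple L"
proof
  assume simple: "na_simple L"
  define v where "v = inv u"
  have uc [simp]: "u \<in> carrier R" using u(3) by (simp add: na_units_def)
  obtain v' w' where "v' \<in> carrier R" "w' \<in> carrier R" "v' \<otimes> u = \<one>" "u \<otimes> w' = \<one>"
    using u(3) by (auto simp: na_units_def)
  then have v: "v \<in> carrier R" "v \<otimes> u = \<one>" "u \<otimes> v = \<one>"
    using middle_nucleus_inv_eq[OF u(1)] unfolding v_def by metis+
  note mid = middle_nucleusD[OF u(1)] and right = right_nucleusD[OF u(2)]
  \<comment> \<open>Right multiplications by \<open>u\<close> and \<open>v\<close> are mutually
    inverse: one composite uses the middle nucleus, the other the right nucleus.\<close>
  have uv: "(r \<otimes> u) \<otimes> v = r" if "r \<in> carrier R" for r using that mid v by simp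
  have vu: "(r \<otimes> v) \<otimes> u = r" if "r \<in> carrier R" for r using that right v by simp
  \<comment> \<open>Nucleus membership only yields \<open>v (u t) = t\<close>; the opposite order needs the injectivity of
    left multiplication by \<open>v\<close>, which is inherited from the bijection \<open>\<sigma>\<^sup>n\<close>.\<close>
  have luv: "u \<otimes> (v \<otimes> t) = t" if t: "t \<in> carrier R" for t
  proof -
    let ?a = "u \<otimes> (v \<otimes> t)"
    have vx: "v \<otimes> x = pw n (x \<otimes> v)" if "x \<in> carrier R" for x
      using that v right[of v "x \<otimes> v"] vu[of x] conj[of "x \<otimes> v"] by (simp add: v_def)
    have "v \<otimes> ?a = v \<otimes> t" using t v mid[of v "v \<otimes> t"] by simp
    then have "pw n (?a \<otimes> v) = pw n (t \<otimes> v)" using vx t v by simp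
    then have "pw (- n) (pw n (?a \<otimes> v)) = pw (- n) (pw n (t \<otimes> v))" by simp
    then have "?a \<otimes> v = t \<otimes> v" using t v by (simp add: pw_pw)
    then show ?thesis using vu[of ?a] vu[of t] t v by simp
  qed
  \<comment> \<open>Condition (i) without the inverse: \<open>monom u n\<close> commutes with the
    constant \<open>t\<close>.\<close>
  have comm: "u \<otimes> pw n t = t \<otimes> u" if t: "t \<in> carrier R" for t
    using t v conj[of t] right[of u "v \<otimes> t"] luv[of t] by (simp add: v_def)
  \<comment> \<open>Condition (ii) passes to all integer powers; at \<open>r = \<one>\<close> it
    says that they fix \<open>u\<close>.\<close>
  have pwu: "pw k (r \<otimes> u) = pw k r \<otimes> u" if r: "r \<in> carrier R" for k r
  proof (induction k rule: int_induct[where k = 0])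
    case (step1 i)
    then show ?case using r by (simp add: pw_add_one lin)
  next
    case (step2 i)
    let ?s = "pw (i - 1) r"
    have "\<sigma> (?s \<otimes> u) = pw i r \<otimes> u"
      using r lin[of ?s] pw_add_one[of r "i - 1"] by simp
    then have "pw (i - 1) (r \<otimes> u) = pw (-1) (\<sigma> (?s \<otimes> u))"
      using step2 r pw_diff_one[of "r \<otimes> u" i] by simp
    also have "\<dots> = ?s \<otimes> u" using r pw_pw[of "?s \<otimes> u" "-1" 1] by simp
    finally show ?case .
  qed simp
  \<comment> \<open>The coefficient of \<open>f c\<close> at \<open>k\<close> is
    \<open>f (k - n) \<otimes> pw (k - n) u\<close>, and the powers of \<sigma> fix
    \<open>u\<close>.\<close>
  define T where "T f = (\<lambda>k. f k \<ominus> f (k - n) \<otimes> u)" for f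
  have T_closed: "T f \<in> carrier L" if f: "f \<in> carrier L" for f
  proof -
    have "pw k u = u" for k using pwu[of \<one> k] by simp
    then have "(\<lambda>k. f (k - n) \<otimes> u) \<in> carrier L"
      using f laurent_mult_closed[of f "monom u n"] by (simp add: monom_mult_right)
    then show ?thesis
      using laurent_add_closed[OF f laurent_uminus_closed] by (simp add: T_def laurent_add a_minus_def)
  qed
  \<comment> \<open>In each term \<open>pwu\<close> brings \<open>u\<close> out of the power of
    \<sigma>, and the right nucleus then brings it out of the product.\<close>
  have T_left: "s \<otimes>\<^bsub>L\<^esub> T f = T (s \<otimes>\<^bsub>L\<^esub> f)" if f: "f \<in> carrier L" and s: "s \<in> carrier L" for f s
  proof
    fix k
    have fc: "f i \<in> carrier R" and sc: "s i \<in> carrier R" for i using f s by (simp_all add: laurent_coeff)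
    have F: "finite (supp s)" using s by (simp add: laurent_carrier)
    let ?m = "\<lambda>k i. s i \<otimes> pw i (f (k - i))"
    have "(s \<otimes>\<^bsub>L\<^esub> T f) k = (\<Oplus>i\<in>supp s. s i \<otimes> pw i (T f (k - i)))"
      using laurent_mult[OF s T_closed[OF f] F order_refl] .
    also have "\<dots> = (\<Oplus>i\<in>supp s. ?m k i \<ominus> ?m (k - n) i \<otimes> u)"
    proof (rule finsum_cong')
      fix i
      have "s i \<otimes> pw i (T f (k - i)) = s i \<otimes> pw i (f (k - i) \<ominus> f (k - n - i) \<otimes> u)"
        by (simp add: T_def algebra_simps)
      also have "\<dots> = s i \<otimes> (pw i (f (k - i)) \<ominus> pw i (f (k - n - i)) \<otimes> u)"
        using fc by (simp add: hom_a_minus[OF pw_hom] pwu)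
      also have "\<dots> = ?m k i \<ominus> s i \<otimes> (pw i (f (k - n - i)) \<otimes> u)"
        using fc sc by (simp add: hom_a_minus[OF l_mult_hom])
      also have "\<dots> = ?m k i \<ominus> ?m (k - n) i \<otimes> u" using fc sc right by simp
      finally show "s i \<otimes> pw i (T f (k - i)) = ?m k i \<ominus> ?m (k - n) i \<otimes> u" .
    qed (use fc sc in auto)
    also have "\<dots> = (\<Oplus>i\<in>supp s. ?m k i) \<ominus> (\<Oplus>i\<in>supp s. ?m (k - n) i \<otimes> u)"
      using fc sc by (intro finsum_a_minus) auto
    also have "(\<Oplus>i\<in>supp s. ?m (k - n) i \<otimes> u) = (\<Oplus>i\<in>supp s. ?m (k - n) i) \<otimes> u"
      using fc sc by (intro hom_finsum[OF r_mult_hom, symmetric]) auto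
    finally show "(s \<otimes>\<^bsub>L\<^esub> T f) k = T (s \<otimes>\<^bsub>L\<^esub> f) k"
      using laurent_mult[OF s f F order_refl] by (simp add: T_def)
  qed
  have T_right: "T f \<otimes>\<^bsub>L\<^esub> s = T (f \<otimes>\<^bsub>L\<^esub> s)" if f: "f \<in> carrier L" and s: "s \<in> carrier L" for f s
  proof
    fix k
    have fc: "f i \<in> carrier R" and sc: "s i \<in> carrier R" for i using f s by (simp_all add: laurent_coeff)
    \<comment> \<open>Chosen so that \<open>B\<close> contains the support of \<open>f\<close>,
      while its translate \<open>?A\<close> by \<open>n\<close> contains both that support and the
      support shifted by \<open>n\<close>.\<close>
    define B where "B = supp f \<union> (\<lambda>i. i - n) ` supp f"
    let ?A = "(\<lambda>i. i + n) ` B"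
    have FB: "finite B" "supp f \<subseteq> B" using f by (auto simp: laurent_carrier B_def)
    then have FA: "finite ?A" by simp
    have A: "i \<in> ?A" if "i - n \<in> B" for i
      using imageI[OF that, of "\<lambda>i. i + n"] by simp
    have sfA: "supp f \<subseteq> ?A"
    proof
      fix i assume "i \<in> supp f"
      then show "i \<in> ?A" by (intro A) (simp add: B_def)
    qed
    have "supp (T f) \<subseteq> ?A"
    proof
      fix i assume i: "i \<in> supp (T f)"
      have "f i \<noteq> \<zero> \<or> f (i - n) \<noteq> \<zero>"
      proof (rule ccontr)
        assume "\<not> ?thesis"
        then have "T f i = \<zero>" by (simp add: T_def a_minus_def)
        then show False using i by simp
      qed
      then show "i \<in> ?A"
      proof
        assume "f i \<noteq> \<zero>"
        then show ?thesis using sfA by blast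
      next
        assume "f (i - n) \<noteq> \<zero>"
        then show ?thesis using FB(2) by (intro A) blast
      qed
    qed
    note TA = laurent_mult[OF T_closed[OF f] s FA this]
    let ?m = "\<lambda>k i. f i \<otimes> pw i (s (k - i))"
    have "(T f \<otimes>\<^bsub>L\<^esub> s) k = (\<Oplus>i\<in>?A. ?m k i \<ominus> ?m (k - n) (i - n) \<otimes> u)"
      unfolding TA
    proof (rule finsum_cong')
      fix i
      let ?t = "pw (i - n) (s (k - i))"
      \<comment> \<open>Splitting off \<open>pw n\<close> lets \<open>comm\<close> move
        \<open>u\<close> to the right of \<open>?t\<close>, once the middle nucleus has regrouped
        the product.\<close>
      have "pw i (s (k - i)) = pw n ?t" using sc by (simp add: pw_pw)
      then have "(f (i - n) \<otimes> u) \<otimes> pw i (s (k - i)) = f (i - n) \<otimes> (?t \<otimes> u)"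
        using fc sc mid comm by simp
      also have "\<dots> = ?m (k - n) (i - n) \<otimes> u" using fc sc right by simp
      finally show "T f i \<otimes> pw i (s (k - i)) = ?m k i \<ominus> ?m (k - n) (i - n) \<otimes> u"
        using fc sc by (simp add: T_def hom_a_minus[OF r_mult_hom])
    qed (use fc sc in auto)
    also have "\<dots> = (\<Oplus>i\<in>?A. ?m k i) \<ominus> (\<Oplus>i\<in>?A. ?m (k - n) (i - n) \<otimes> u)"
      using fc sc by (intro finsum_a_minus) auto
    \<comment> \<open>Undoing the translation by \<open>n\<close> turns this into the sum for the
      coefficient of the product at \<open>k - n\<close>.\<close>
    also have "(\<Oplus>i\<in>?A. ?m (k - n) (i - n) \<otimes> u) = (\<Oplus>i\<in>B. ?m (k - n) i \<otimes> u)"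
      using fc sc by (subst add.finprod_reindex) auto
    also have "\<dots> = (\<Oplus>i\<in>B. ?m (k - n) i) \<otimes> u"
      using fc sc by (intro hom_finsum[OF r_mult_hom, symmetric]) auto
    finally show "(T f \<otimes>\<^bsub>L\<^esub> s) k = T (f \<otimes>\<^bsub>L\<^esub> s) k"
      using laurent_mult[OF f s FA sfA] laurent_mult[OF f s FB] by (simp add: T_def)
  qed
  have "na_ideal (T ` carrier L) L"
  proof (rule na_ideal_laurentI)
    have "T (\<lambda>k. \<zero>) = (\<lambda>k. \<zero>)" by (simp add: T_def a_minus_def)
    then show "(\<lambda>k. \<zero>) \<in> T ` carrier L"
      by (intro image_eqI[of _ _ "\<lambda>k. \<zero>"]) (simp_all add: laurent_carrier)
  next
    fix F G assume "F \<in> T ` carrier L" "G \<in> T ` carrier L"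
    then obtain f g where fg: "f \<in> carrier L" "g \<in> carrier L" "F = T f" "G = T g" by blast
    have fc: "f i \<in> carrier R" and gc: "g i \<in> carrier R" for i using fg by (simp_all add: laurent_coeff)
    have "(\<lambda>k. F k \<oplus> G k) = T (f \<oplus>\<^bsub>L\<^esub> g)"
      using fc gc by (auto simp: fg T_def laurent_add l_distr a_minus_def minus_add a_ac)
    then show "(\<lambda>k. F k \<oplus> G k) \<in> T ` carrier L" using fg by (simp add: laurent_add_closed)
  next
    fix F assume "F \<in> T ` carrier L"
    then obtain f where f: "f \<in> carrier L" "F = T f" by blast
    have fc: "f i \<in> carrier R" for i using f by (simp add: laurent_coeff)
    have "(\<lambda>k. \<ominus> F k) = T (\<lambda>k. \<ominus> f k)"
      using fc by (auto simp: f T_def hom_a_inv[OF r_mult_hom] a_minus_def minus_add)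
    then show "(\<lambda>k. \<ominus> F k) \<in> T ` carrier L" using f by (simp add: laurent_uminus_closed)
  next
    fix F s assume "F \<in> T ` carrier L" "s \<in> carrier L"
    then show "s \<otimes>\<^bsub>L\<^esub> F \<in> T ` carrier L \<and> F \<otimes>\<^bsub>L\<^esub> s \<in> T ` carrier L"
      by (auto simp: T_left T_right laurent_mult_closed)
  qed (auto simp: T_closed)
  then consider "T ` carrier L = {\<lambda>k. \<zero>}" | "T ` carrier L = carrier L"
    using simple by (auto simp: na_simple_def laurent_zero)
  moreover have one: "\<one> \<noteq> \<zero>"
  proof
    assume "\<one> = \<zero>"
    then have "x = \<zero>" if "x \<in> carrier R" for x using that l_one[of x] by simp
    then have "f = (\<lambda>k. \<zero>)" if "f \<in> carrier L" for f using that by (auto simp: laurent_coeff)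
    then have "carrier L = {\<zero>\<^bsub>L\<^esub>}" by (auto simp: laurent_zero laurent_carrier)
    then show False using simple by (simp add: na_simple_def)
  qed
  ultimately show False
  proof cases
    case 1
    then have "T (monom \<one> 0) = (\<lambda>k. \<zero>)" using monom_closed[of \<one> 0] by blast
    then have "T (monom \<one> 0) 0 = \<zero>" by simp
    then show False using one n by (simp add: T_def monom_def a_minus_def)
  next
    case 2
    then obtain f where f: "f \<in> carrier L" "T f = monom \<one> 0"
      by (metis imageE monom_closed one_closed)
    have "r = \<zero>" if "r \<in> carrier R" "r \<otimes> u = \<zero>" for r
      using uv[of r] that v by simp
    then have "T f \<noteq> monom \<one> 0"
      unfolding T_def by (rule diff_twisted_shift_ne_one[OF n f(1) uc _ one])
    then show False using f(2) by contradiction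
  qed
qed

section \<open>Non-zero ideals over a \<sigma>-simple ring\<close>

text \<open>With the alternative stated for a single ideal under \<sigma>-simplicity alone,
  simplicity follows by excluding the second case.\<close>

lemma ideal_eq_carrier_or_twisting_unit:
  assumes ss: "sigma_simple \<sigma> R" and I: "na_ideal I L" "I \<noteq> {\<zero>\<^bsub>L\<^esub>}"
  shows "I = carrier L \<or>
    (\<exists>u \<in> middle_nucleus R \<inter> right_nucleus R \<inter> na_units R. \<exists>n::int. n \<noteq> 0 \<and>
        (\<forall>r\<in>carrier R. pw n r = (inv u \<otimes> r) \<otimes> u \<and> \<sigma> (r \<otimes> u) = \<sigma> r \<otimes> u))"
proof -
  have grp: "additive_subgroup I L" using I(1) by (simp add: na_ideal_def)
  have subL: "I \<subseteq> carrier L" using grp by (rule additive_subgroup.a_subset)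
  have coeff: "g k \<in> carrier R" if "g \<in> I" for g k
    using that subL laurent_coeff by blast
  have zeroI: "(\<lambda>k. \<zero>) \<in> I" using additive_subgroup.zero_closed[OF grp] by (simp add: laurent_zero)
  have addI: "(\<lambda>k. g k \<oplus> h k) \<in> I" if "g \<in> I" "h \<in> I" for g h
    using additive_subgroup.a_closed[OF grp that] by (simp add: laurent_add)
  have uminusI: "(\<lambda>k. \<ominus> g k) \<in> I" if "g \<in> I" for g
  proof -
    have "inv\<^bsub>add_monoid L\<^esub> g \<in> I"
      using additive_subgroup.a_subgroup[OF grp] that by (rule subgroup.m_inv_closed)
    then show ?thesis using that subL laurent_a_inv[of g] by (auto simp: a_inv_def)
  qed
  have leftI: "(\<lambda>k. r \<otimes> pw m (g (k - m))) \<in> I" if "g \<in> I" "r \<in> carrier R" for g r m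
  proof -
    have "monom r m \<otimes>\<^bsub>L\<^esub> g \<in> I"
      using I(1) that monom_closed[of r m] by (simp add: na_ideal_def)
    then show ?thesis using that subL by (simp add: monom_mult_left subsetD)
  qed
  have rightI: "(\<lambda>k. g (k - m) \<otimes> pw (k - m) s) \<in> I" if "g \<in> I" "s \<in> carrier R" for g s m
  proof -
    have "g \<otimes>\<^bsub>L\<^esub> monom s m \<in> I"
      using I(1) that monom_closed[of s m] by (simp add: na_ideal_def)
    then show ?thesis using that subL by (simp add: monom_mult_right subsetD)
  qed
  \<comment> \<open>Right multiplication by a power of \<open>X\<close> is a pure shift. Left
    multiplication also applies a power of \<sigma>, which shifting back isolates in
    \<open>pwI\<close>.\<close>
  have shiftI: "(\<lambda>k. g (k - m)) \<in> I" if "g \<in> I" for g m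
    using rightI[OF that one_closed, of m] that by (simp add: coeff)
  have pwI: "(\<lambda>k. pw m (g k)) \<in> I" if "g \<in> I" for g m
    using shiftI[OF leftI[OF that one_closed, of m], of "- m"] that by (simp add: coeff)
  define W where "W d = {g \<in> I. \<forall>k. k < 0 \<or> k > int d \<longrightarrow> g k = \<zero>}" for d
  have "\<exists>d. \<exists>g\<in>W d. g \<noteq> (\<lambda>k. \<zero>)"
  proof -
    obtain g where g: "g \<in> I" "g \<noteq> (\<lambda>k. \<zero>)" using I(2) zeroI by (auto simp: laurent_zero)
    let ?a = "Min (supp g)" and ?b = "Max (supp g)"
    have F: "finite (supp g)" using g(1) subL by (auto simp: laurent_carrier)
    have g0: "g k = \<zero>" if "k < ?a \<or> k > ?b" for k
      using that F by (metis (mono_tags, lifting) Max_ge Min_le linorder_not_less mem_Collect_eq)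
    \<comment> \<open>The lowest term is moved to degree 0; the double negation fits the form of
      \<open>shiftI\<close>.\<close>
    let ?h = "\<lambda>k. g (k - - ?a)"
    have "?h k = \<zero>" if "k < 0 \<or> k > int (nat (?b - ?a))" for k
      using that by (intro g0) linarith
    then have "?h \<in> W (nat (?b - ?a))" using shiftI[OF g(1), of "- ?a"] by (simp add: W_def)
    moreover have "?h \<noteq> (\<lambda>k. \<zero>)"
    proof
      assume "?h = (\<lambda>k. \<zero>)"
      then have "g k = \<zero>" for k using fun_cong[of ?h "\<lambda>k. \<zero>" "k - ?a"] by simp
      then show False using g(2) by blast
    qed
    ultimately show ?thesis by blast
  qed
  then obtain d where d: "\<exists>g\<in>W d. g \<noteq> (\<lambda>k. \<zero>)"
    and least: "\<And>e g. e < d \<Longrightarrow> g \<in> W e \<Longrightarrow> g = (\<lambda>k. \<zero>)"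
    using exists_least_iff[of "\<lambda>d. \<exists>g\<in>W d. g \<noteq> (\<lambda>k. \<zero>)"] by blast
  have WI: "g \<in> W d \<Longrightarrow> g \<in> I" and W0: "g \<in> W d \<Longrightarrow> k < 0 \<or> k > int d \<Longrightarrow> g k = \<zero>" for g k
    by (auto simp: W_def)
  have Wc [simp]: "g \<in> W d \<Longrightarrow> g k \<in> carrier R" for g k using WI by (simp add: coeff)
  \<comment> \<open>The following operations act coefficientwise and preserve zero coefficients, so
    they do not leave the window.\<close>
  have W_add: "(\<lambda>k. g k \<oplus> h k) \<in> W d" if "g \<in> W d" "h \<in> W d" for g h
    using that addI by (simp add: W_def)
  have W_uminus: "(\<lambda>k. \<ominus> g k) \<in> W d" if "g \<in> W d" for g
    using that uminusI by (simp add: W_def)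
  have W_pw: "(\<lambda>k. pw m (g k)) \<in> W d" if "g \<in> W d" for g m
    using that pwI by (simp add: W_def)
  have W_left: "(\<lambda>k. r \<otimes> g k) \<in> W d" if "g \<in> W d" "r \<in> carrier R" for g r
    using that leftI[of g r 0] by (simp add: W_def)
  have W_right: "(\<lambda>k. g k \<otimes> pw k s) \<in> W d" if "g \<in> W d" "s \<in> carrier R" for g s
    using that rightI[of g s 0] by (simp add: W_def)
  \<comment> \<open>Without constant term, \<open>g\<close> shifted down by one fits into a smaller
    window, which is trivial by minimality of \<open>d\<close>.\<close>
  have low: "g = (\<lambda>k. \<zero>)" if g: "g \<in> W d" "g 0 = \<zero>" for g
  proof (cases d)
    case 0
    then have "g k = \<zero>" for k using g W0[OF g(1), of k] by (metis linorder_neq_iff of_nat_0)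
    then show ?thesis by blast
  next
    case (Suc e)
    let ?h = "\<lambda>k. g (k - - 1)"
    have "?h k = \<zero>" if "k < 0 \<or> k > int e" for k
      using that g(2) W0[OF g(1), of "k - - 1"] Suc by (cases "k = - 1") auto
    then have "?h \<in> W e" using shiftI[OF WI[OF g(1)], of "- 1"] by (simp add: W_def)
    then have "?h = (\<lambda>k. \<zero>)" using Suc by (intro least) auto
    then have "g k = \<zero>" for k using fun_cong[of ?h "\<lambda>k. \<zero>" "k - 1"] by simp
    then show ?thesis by blast
  qed
  have high: "g = (\<lambda>k. \<zero>)" if g: "g \<in> W d" "g (int d) = \<zero>" for g
  proof (cases d)
    case 0
    then show ?thesis using low g by simp
  next
    case (Suc e)
    have "g k = \<zero>" if "k < 0 \<or> k > int e" for k
      using that g(2) W0[OF g(1), of k] Suc by (cases "k = int d") auto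
    then have "g \<in> W e" using WI[OF g(1)] by (simp add: W_def)
    then show ?thesis using Suc by (intro least) auto
  qed
  have low_eq: "g = h" if "g \<in> W d" "h \<in> W d" "g 0 = h 0" for g h
  proof -
    have "(\<lambda>k. g k \<oplus> \<ominus> h k) \<in> W d" using that W_add W_uminus by blast
    moreover have "g 0 \<oplus> \<ominus> h 0 = \<zero>" using that by (simp add: r_neg)
    ultimately have "(\<lambda>k. g k \<oplus> \<ominus> h k) = (\<lambda>k. \<zero>)" using low by blast
    then have "g k \<ominus> h k = \<zero>" for k by (metis a_minus_def)
    then show ?thesis using that minus_eq_zero_iff by auto
  qed
  have J: "sigma_ideal \<sigma> ((\<lambda>g. g j) ` W d) R" for j
  proof -
    let ?J = "(\<lambda>g. g j) ` W d"
    have "subgroup ?J (add_monoid R)"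
    proof (rule subgroup.intro)
      show "?J \<subseteq> carrier (add_monoid R)" by auto
      show "\<one>\<^bsub>add_monoid R\<^esub> \<in> ?J" using zeroI by (force simp: W_def)
      fix x assume "x \<in> ?J"
      then obtain g where g: "g \<in> W d" "x = g j" by blast
      then have "\<ominus> x \<in> ?J" using W_uminus[OF g(1)] by force
      then show "inv\<^bsub>add_monoid R\<^esub> x \<in> ?J" by (simp add: a_inv_def)
      fix y assume "y \<in> ?J"
      then obtain h where h: "h \<in> W d" "y = h j" by blast
      then show "x \<otimes>\<^bsub>add_monoid R\<^esub> y \<in> ?J" using g W_add[OF g(1) h(1)] by force
    qed
    moreover have "r \<otimes> a \<in> ?J \<and> a \<otimes> r \<in> ?J" if a: "a \<in> ?J" and r: "r \<in> carrier R" for a r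
    proof -
      obtain g where g: "g \<in> W d" "a = g j" using a by blast
      \<comment> \<open>Right multiplication by a constant acts on the coefficient at
        \<open>j\<close> through \<open>pw j\<close>; the constant is chosen to cancel this
        twist.\<close>
      have "a \<otimes> pw j (pw (- j) r) \<in> ?J" using W_right[OF g(1), of "pw (- j) r"] g r by force
      then show ?thesis using W_left[OF g(1) r] g r by (force simp: pw_pw)
    qed
    moreover have "\<sigma> ` ?J = ?J"
    proof
      show "\<sigma> ` ?J \<subseteq> ?J" using W_pw[of _ 1] by force
      show "?J \<subseteq> \<sigma> ` ?J"
      proof
        fix a assume "a \<in> ?J"
        then obtain g where g: "g \<in> W d" "a = g j" by blast
        have "a = \<sigma> (pw (-1) (g j))" using g pw_pw[of "g j" 1 "-1"] by simp
        then show "a \<in> \<sigma> ` ?J" using W_pw[OF g(1), of "-1"] by force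
      qed
    qed
    ultimately show ?thesis
      by (auto simp: sigma_ideal_def na_ideal_def intro: additive_subgroupI)
  qed
  \<comment> \<open>The assumption makes the \<sigma>-ideal of coefficients at \<open>j\<close>
    non-zero, hence all of \<open>R\<close>. It is used for \<open>j = 0\<close> and
    \<open>j = int d\<close>.\<close>
  have unit_coeff: "\<exists>f\<in>W d. f j = \<one>" if "\<And>g. g \<in> W d \<Longrightarrow> g j = \<zero> \<Longrightarrow> g = (\<lambda>k. \<zero>)" for j
  proof -
    have "(\<lambda>g. g j) ` W d \<noteq> {\<zero>}" using d that by blast
    then have "(\<lambda>g. g j) ` W d = carrier R" using ss J by (auto simp: sigma_simple_def)
    then have "\<one> \<in> (\<lambda>g. g j) ` W d" using one_closed by (simp only:)
    then obtain f where "\<one> = f j" "f \<in> W d" by (rule imageE)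
    then show ?thesis by (intro bexI[of _ f]) simp_all
  qed
  obtain f where f: "f \<in> W d" "f 0 = \<one>" using unit_coeff[OF low] by blast
  obtain g where g: "g \<in> W d" "g (int d) = \<one>" using unit_coeff[OF high] by blast
  show ?thesis
  proof (cases d)
    case 0
    have "f k = monom \<one> 0 k" for k using f(2) W0[OF f(1), of k] 0 by (cases k "0::int" rule: linorder_cases) (simp_all add: monom_def)
    then have one: "monom \<one> 0 \<in> I" using WI[OF f(1)] by presburger
    have "h \<in> I" if h: "h \<in> carrier L" for h
    proof -
      have "h \<otimes>\<^bsub>L\<^esub> monom \<one> 0 \<in> I" using I(1) one h by (simp add: na_ideal_def)
      then show ?thesis using h by (simp add: monom_mult_right laurent_coeff)
    qed
    then show ?thesis using subL by blast
  next
    case (Suc e)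
    define u where "u = f (int d)"
    define b where "b = g 0"
    have uc [simp]: "u \<in> carrier R" and bc [simp]: "b \<in> carrier R"
      using f g by (simp_all add: u_def b_def)
    have fc [simp]: "f k \<in> carrier R" for k using f by simp
    \<comment> \<open>Since \<open>f 0 = \<one>\<close>, both elements have constant coefficient
      \<open>\<sigma> r\<close>; the next three facts follow the same pattern.\<close>
    have lin: "\<sigma> (r \<otimes> u) = \<sigma> r \<otimes> u" if r: "r \<in> carrier R" for r
    proof -
      have "(\<lambda>k. pw 1 (r \<otimes> f k)) = (\<lambda>k. \<sigma> r \<otimes> f k)"
        using f r by (intro low_eq W_pw W_left) auto
      from fun_cong[OF this, of "int d"] show ?thesis by (simp add: u_def)
    qed
    have comm: "r \<otimes> u = u \<otimes> pw (int d) r" if r: "r \<in> carrier R" for r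
    proof -
      have "(\<lambda>k. r \<otimes> f k) = (\<lambda>k. f k \<otimes> pw k r)"
        using f r by (intro low_eq W_right W_left) auto
      from fun_cong[OF this, of "int d"] show ?thesis by (simp add: u_def)
    qed
    have right: "(r \<otimes> s) \<otimes> u = r \<otimes> (s \<otimes> u)" if rs: "r \<in> carrier R" "s \<in> carrier R" for r s
    proof -
      have "(\<lambda>k. (r \<otimes> s) \<otimes> f k) = (\<lambda>k. r \<otimes> (s \<otimes> f k))"
        using f rs by (intro low_eq W_left) auto
      from fun_cong[OF this, of "int d"] show ?thesis by (simp add: u_def)
    qed
    have mid: "(r \<otimes> u) \<otimes> t = r \<otimes> (u \<otimes> t)" if rt: "r \<in> carrier R" "t \<in> carrier R" for r t
    proof -
      \<comment> \<open>The twist makes exactly \<open>t\<close> appear in degree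
        \<open>d\<close>.\<close>
      let ?t = "pw (- int d) t"
      have "(\<lambda>k. (r \<otimes> f k) \<otimes> pw k ?t) = (\<lambda>k. r \<otimes> (f k \<otimes> pw k ?t))"
        using f rt by (intro low_eq W_left W_right) auto
      from fun_cong[OF this, of "int d"] show ?thesis using rt by (simp add: u_def pw_pw)
    qed
    \<comment> \<open>Both have constant coefficient \<open>b\<close>; the top coefficient of
      \<open>g\<close> is \<one>, so \<open>b\<close> is a left inverse of \<open>u\<close>.\<close>
    have "g = (\<lambda>k. b \<otimes> f k)" using f g by (intro low_eq W_left) (auto simp: b_def)
    then have bu: "b \<otimes> u = \<one>" using g(2) by (simp add: u_def)
    \<comment> \<open>Commutation turns the left inverse into a right inverse.\<close>
    then have ub: "u \<otimes> pw (int d) b = \<one>" using comm[of b] by simp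
    have uN: "u \<in> middle_nucleus R" "u \<in> right_nucleus R"
      using mid right by (auto simp: middle_nucleus_def right_nucleus_def associator_def minus_eq_zero_iff)
    have uU: "u \<in> na_units R" using bu ub unfolding na_units_def by (auto intro: pw_closed)
    have "inv u = b" using middle_nucleus_inv_eq(1)[OF uN(1) bc _ bu ub] by simp
    \<comment> \<open>In turn: \<open>(b \<otimes> r) \<otimes> u = b \<otimes> (r \<otimes> u) = b
      \<otimes> (u \<otimes> pw (int d) r) = (b \<otimes> u) \<otimes> pw (int d) r\<close>.\<close>
    moreover have "pw (int d) r = (b \<otimes> r) \<otimes> u" if r: "r \<in> carrier R" for r
      using r right[of b r] comm[of r] mid[of b "pw (int d) r"] bu by simp
    ultimately show ?thesis using uN uU lin Suc by (intro disjI2 bexI[of _ u] exI[of _ "int d"]) auto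
  qed
qed

section \<open>The zero ring and the equivalence\<close>

text \<open>The zero ring is \<sigma>-simple but its Laurent ring is not simple. The equivalence
  survives because \<zero> is then a unit satisfying (i) and (ii) with exponent 1.\<close>

lemma twisting_unit_if_trivial:
  assumes "carrier L = {\<zero>\<^bsub>L\<^esub>}"
  shows "\<exists>u \<in> middle_nucleus R \<inter> right_nucleus R \<inter> na_units R. \<exists>n::int. n \<noteq> 0 \<and>
    (\<forall>r\<in>carrier R. pw n r = (inv u \<otimes> r) \<otimes> u \<and> \<sigma> (r \<otimes> u) = \<sigma> r \<otimes> u)"
proof -
  have triv: "x = \<zero>" if "x \<in> carrier R" for x
  proof -
    have "monom x 0 = (\<lambda>k. \<zero>)" using monom_closed[OF that, of 0] assms by (simp add: laurent_zero)
    then show ?thesis by (metis monom_def)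
  qed
  then have R: "carrier R = {\<zero>}" and one: "\<one> = \<zero>" by auto
  have N: "\<zero> \<in> middle_nucleus R" "\<zero> \<in> right_nucleus R"
    using R by (auto simp: middle_nucleus_def right_nucleus_def associator_def a_minus_def)
  have "\<zero> \<in> na_units R" using R one by (simp add: na_units_def)
  have "inv \<zero> = \<zero>" using middle_nucleus_inv_eq(1)[OF N(1), of \<zero> \<zero>] one by simp
  moreover have "\<sigma> \<zero> = \<zero>" using sigma_closed[of \<zero>] R by simp
  ultimately have "pw 1 r = (inv \<zero> \<otimes> r) \<otimes> \<zero> \<and> \<sigma> (r \<otimes> \<zero>) = \<sigma> r \<otimes> \<zero>" if "r \<in> carrier R" for r
    using triv[OF that] by simp
  moreover have "(1::int) \<noteq> 0" by simp
  ultimately show ?thesis using N \<open>\<zero> \<in> na_units R\<close> by blast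
qed

end

theorem theorem5:
  fixes R :: "('a, 'm) ring_scheme" and \<sigma> :: "'a \<Rightarrow> 'a"
  assumes "nonassoc_ring R"
    and "\<sigma> \<in> iso (add_monoid R) (add_monoid R)"
    and "\<sigma> \<one>\<^bsub>R\<^esub> = \<one>\<^bsub>R\<^esub>"
  shows "na_simple (laurent R \<sigma>) \<longleftrightarrow>
    sigma_simple \<sigma> R \<and>
    \<not> (\<exists>u \<in> middle_nucleus R \<inter> right_nucleus R \<inter> na_units R. \<exists>n::int. n \<noteq> 0 \<and>
        (\<forall>r\<in>carrier R.
           int_iter (carrier R) \<sigma> n r = (inv\<^bsub>R\<^esub> u \<otimes>\<^bsub>R\<^esub> r) \<otimes>\<^bsub>R\<^esub> u \<and>
           \<sigma> (r \<otimes>\<^bsub>R\<^esub> u) = \<sigma> r \<otimes>\<^bsub>R\<^esub> u))"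
proof -
  interpret nonassoc_ring R by (fact assms(1))
  interpret twisted_ring R \<sigma> by unfold_locales (use assms(2,3) in auto)
  show ?thesis (is "?simple \<longleftrightarrow> ?ss \<and> \<not> ?unit")
  proof
    assume ?simple
    then show "?ss \<and> \<not> ?unit"
      using simple_imp_sigma_simple twisting_unit_imp_not_simple by blast
  next
    assume "?ss \<and> \<not> ?unit"
    then show ?simple
      using ideal_eq_carrier_or_twisting_unit twisting_unit_if_trivial
      unfolding na_simple_def by blast
  qed
qed

end
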